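(* Let $\boldsymbol{P}$ and $\boldsymbol{P}'$ be two stochastic tensors in $\mathbb{R}^{[3,n]}$ ($\boldsymbol{P}'$ being regarded as a perturbation of $\boldsymbol{P}$). If $\mathcal{T}(\boldsymbol{P})<1$ then the solution $x\in\mathcal{S}_1$ of $x=\boldsymbol{P}xx$ is unique, and for any $x'\in\mathcal{S}_1$ such that $x'=\boldsymbol{P}'x'x'$ it holds $$\|x-x'\|_1\le\frac{\|\boldsymbol{P}-\boldsymbol{P}'\|_1}{1-\mathcal{T}(\boldsymbol{P})}.$$
   Context: $\mathbb{R}^{[3,n]}$ is the set of real $n\times n\times n$ arrays $\boldsymbol{P}=(\boldsymbol{P}_{ijk})$, $n\ge 2$. $\boldsymbol{P}$ is called stochastic if $\boldsymbol{P}_{ijk}\ge 0$ for all $i,j,k$ and $\sum_{i=1}^n\boldsymbol{P}_{ijk}=1$ for all $j,k$. For $x,y\in\mathbb{R}^n$, $(\boldsymbol{P}xy)_i=\sum_{j,k}\boldsymbol{P}_{ijk}x_jy_k$. The tensor norm is $\|\boldsymbol{P}\|_1=\max_{j,k}\sum_i|\boldsymbol{P}_{ijk}|$. Let $\mathcal{S}_1=\{x\in\mathbb{R}^n: x\ge 0,\ \|x\|_1=1\}$ (the stochastic vectors) and $\mathcal{Z}_1=\{x\in\mathbb{R}^n:\sum_i x_i=0,\ \|x\|_1=1\}$. Definition: $\mathcal{T}(\boldsymbol{P})=\max_{x\in\mathcal{S}_1}\max_{y\in\mathcal{Z}_1}\|\boldsymbol{P}xy+\boldsymbol{P}yx\|_1$.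 *)

theory Defs
  imports "HOL-Analysis.Analysis"
begin

text \<open>The entry \<open>P\<^bsub>ijk\<^esub>\<close> is \<open>P $ i $ j $ k\<close>.\<close>

type_synonym 'n cubic_tensor = "real ^ 'n ^ 'n ^ 'n"

definition norm1 :: "real ^ 'n::finite \<Rightarrow> real" where
  "norm1 x = (\<Sum>i\<in>UNIV. \<bar>x $ i\<bar>)"

definition tensor_norm1 :: "('n::finite) cubic_tensor \<Rightarrow> real" where
  "tensor_norm1 P = Max (range (\<lambda>(j, k). \<Sum>i\<in>UNIV. \<bar>P $ i $ j $ k\<bar>))"

definition tensor_app :: "('n::finite) cubic_tensor \<Rightarrow> real ^ 'n \<Rightarrow> real ^ 'n \<Rightarrow> real ^ 'n" where
  "tensor_app P x y = (\<chi> i. \<Sum>j\<in>UNIV. \<Sum>k\<in>UNIV. P $ i $ j $ k * x $ j * y $ k)"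

definition stochastic_tensor :: "('n::finite) cubic_tensor \<Rightarrow> bool" where
  "stochastic_tensor P \<longleftrightarrow>
     (\<forall>i j k. 0 \<le> P $ i $ j $ k) \<and> (\<forall>j k. (\<Sum>i\<in>UNIV. P $ i $ j $ k) = 1)"

definition stochastic_vectors :: "(real ^ 'n::finite) set" where
  "stochastic_vectors = {x. (\<forall>i. 0 \<le> x $ i) \<and> norm1 x = 1}"

definition zero_sum_sphere :: "(real ^ 'n::finite) set" where
  "zero_sum_sphere = {x. (\<Sum>i\<in>UNIV. x $ i) = 0 \<and> norm1 x = 1}"

text \<open>
  The two suprema are maxima once the dimension is at least 2, see \<open>ergodicity_coeff_attained\<close>
  below; in dimension 1 the set \<open>zero_sum_sphere\<close> is empty.
\<close>

definition ergodicity_coeff :: "('n::finite) cubic_tensor \<Rightarrow> real" where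
  "ergodicity_coeff P =
     (SUP x\<in>stochastic_vectors. SUP y\<in>zero_sum_sphere.
        norm1 (tensor_app P x y + tensor_app P y x))"

lemma norm_le_norm1: "norm x \<le> norm1 x"
  unfolding norm1_def by (rule norm_le_l1_cart)

lemma continuous_on_norm1 [continuous_intros]:
  "continuous_on A f \<Longrightarrow> continuous_on A (\<lambda>z. norm1 (f z))"
  unfolding norm1_def by (intro continuous_intros)

lemma continuous_on_tensor_app [continuous_intros]:
  "continuous_on A f \<Longrightarrow> continuous_on A g \<Longrightarrow> continuous_on A (\<lambda>z. tensor_app P (f z) (g z))"
  unfolding tensor_app_def by (intro continuous_intros)

lemma compact_stochastic_vectors: "compact (stochastic_vectors :: (real ^ 'n::finite) set)"
proof -
  have "bounded (stochastic_vectors :: (real ^ 'n) set)"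
  proof (rule boundedI)
    show "norm x \<le> 1" if "x \<in> stochastic_vectors" for x :: "real ^ 'n"
      using that norm_le_norm1[of x] by (simp add: stochastic_vectors_def)
  qed
  moreover have "closed (stochastic_vectors :: (real ^ 'n) set)"
    unfolding stochastic_vectors_def
    by (intro closed_Collect_conj closed_Collect_all closed_Collect_le closed_Collect_eq
        continuous_intros)
  ultimately show ?thesis by (simp add: compact_eq_bounded_closed)
qed

lemma compact_zero_sum_sphere: "compact (zero_sum_sphere :: (real ^ 'n::finite) set)"
proof -
  have "bounded (zero_sum_sphere :: (real ^ 'n) set)"
  proof (rule boundedI)
    show "norm x \<le> 1" if "x \<in> zero_sum_sphere" for x :: "real ^ 'n"
      using that norm_le_norm1[of x] by (simp add: zero_sum_sphere_def)
  qed
  moreover have "closed (zero_sum_sphere :: (real ^ 'n) set)"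
    unfolding zero_sum_sphere_def
    by (intro closed_Collect_conj closed_Collect_eq continuous_intros)
  ultimately show ?thesis by (simp add: compact_eq_bounded_closed)
qed

lemma stochastic_vectors_nonempty: "(stochastic_vectors :: (real ^ 'n::finite) set) \<noteq> {}"
proof -
  obtain a :: 'n where True by blast
  have "axis a 1 \<in> (stochastic_vectors :: (real ^ 'n) set)"
    by (auto simp: stochastic_vectors_def norm1_def axis_def if_distrib cong: if_cong)
  then show ?thesis by blast
qed

lemma zero_sum_sphere_nonempty:
  assumes "CARD('n::finite) \<ge> 2"
  shows "(zero_sum_sphere :: (real ^ 'n) set) \<noteq> {}"
proof -
  obtain a b :: 'n where ab: "a \<noteq> b"
  proof -
    have "\<not> card (UNIV :: 'n set) \<le> Suc 0" using assms by simp
    then show thesis using that by (auto simp: card_le_Suc0_iff_eq)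
  qed
  let ?y = "\<chi> i. (if i = a then 1/2 else 0) - (if i = b then 1/2 else (0::real))"
  have "(\<Sum>i\<in>UNIV. ?y $ i) = 0"
    by (simp add: sum_subtractf)
  moreover have "norm1 ?y = 1"
  proof -
    have "\<bar>?y $ i\<bar> = (if i = a then 1/2 else 0) + (if i = b then 1/2 else 0)" for i
      using ab by simp
    then show ?thesis
      unfolding norm1_def by (simp only: sum.distrib) simp
  qed
  ultimately have "?y \<in> zero_sum_sphere"
    by (simp add: zero_sum_sphere_def)
  then show ?thesis by blast
qed

lemma ergodicity_coeff_attained:
  fixes P :: "('n::finite) cubic_tensor"
  assumes "CARD('n) \<ge> 2"
  shows "\<exists>x\<in>stochastic_vectors. \<exists>y\<in>zero_sum_sphere.
           ergodicity_coeff P = norm1 (tensor_app P x y + tensor_app P y x) \<and>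
           (\<forall>x'\<in>stochastic_vectors. \<forall>y'\<in>zero_sum_sphere.
              norm1 (tensor_app P x' y' + tensor_app P y' x') \<le> ergodicity_coeff P)"
proof -
  define g where "g x y = norm1 (tensor_app P x y + tensor_app P y x)" for x y
  let ?S = "stochastic_vectors :: (real ^ 'n) set"
  let ?Z = "zero_sum_sphere :: (real ^ 'n) set"
  have Z: "?Z \<noteq> {}" using assms by (rule zero_sum_sphere_nonempty)
  have "continuous_on (?S \<times> ?Z) (\<lambda>p. g (fst p) (snd p))"
    unfolding g_def by (intro continuous_intros)
  moreover have "compact (?S \<times> ?Z)" "?S \<times> ?Z \<noteq> {}"
    using compact_stochastic_vectors compact_zero_sum_sphere stochastic_vectors_nonempty Z
    by (auto intro: compact_Times)
  ultimately obtain p where p: "p \<in> ?S \<times> ?Z"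
    and max: "\<forall>q\<in>?S \<times> ?Z. g (fst q) (snd q) \<le> g (fst p) (snd p)"
    using continuous_attains_sup[of "?S \<times> ?Z" "\<lambda>p. g (fst p) (snd p)"] by blast
  define x y where "x = fst p" and "y = snd p"
  have x: "x \<in> ?S" and y: "y \<in> ?Z" using p by (auto simp: x_def y_def)
  have le: "g x' y' \<le> g x y" if "x' \<in> ?S" "y' \<in> ?Z" for x' y'
    using bspec[OF max, of "(x', y')"] that by (simp add: x_def y_def)
  have inner: "(SUP y'\<in>?Z. g x' y') \<le> g x y" if "x' \<in> ?S" for x'
    using Z le[OF that] by (rule cSUP_least)
  have inner_eq: "(SUP y'\<in>?Z. g x y') = g x y"
  proof (rule cSup_eq_maximum)
    show "g x y \<in> g x ` ?Z" using y by (rule imageI)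
    show "z \<le> g x y" if "z \<in> g x ` ?Z" for z using that le[OF x] by blast
  qed
  have "(SUP x'\<in>?S. SUP y'\<in>?Z. g x' y') = g x y"
  proof (rule cSup_eq_maximum)
    show "g x y \<in> (\<lambda>x'. SUP y'\<in>?Z. g x' y') ` ?S"
      by (rule image_eqI[where x = x]) (simp_all only: inner_eq x)
    show "z \<le> g x y" if "z \<in> (\<lambda>x'. SUP y'\<in>?Z. g x' y') ` ?S" for z
      using that inner by blast
  qed
  then have eq: "ergodicity_coeff P = g x y"
    by (simp only: ergodicity_coeff_def g_def)
  show ?thesis
  proof (intro bexI[OF _ x] bexI[OF _ y] conjI ballI)
    show "ergodicity_coeff P = norm1 (tensor_app P x y + tensor_app P y x)"
      using eq by (simp only: g_def)
    show "norm1 (tensor_app P x' y' + tensor_app P y' x') \<le> ergodicity_coeff P"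
      if "x' \<in> ?S" "y' \<in> ?Z" for x' y'
      using le[OF that] eq by (simp only: g_def)
  qed
qed

end

theory Submission
  imports Defs
begin

text \<open>
  The difference \<open>P x x - P y y\<close> equals \<open>P m d + P d m\<close> for the midpoint \<open>m\<close> and the difference
  \<open>d\<close> of \<open>x\<close> and \<open>y\<close>. Since \<open>m\<close> is stochastic and \<open>d\<close> has zero sum, the map \<open>x \<mapsto> P x x\<close> contracts
  the \<open>1\<close>-norm on stochastic vectors by the factor \<open>\<T>(P) < 1\<close>. This gives existence and uniqueness
  of the fixed point, and the perturbation bound follows from the splitting
  \<open>x - x' = (P x x - P x' x') + (P - P') x' x'\<close>.
\<close>

lemma norm1_nonneg: "0 \<le> norm1 x"
  by (simp add: norm1_def sum_nonneg)

lemma norm1_eq_0_iff: "norm1 x = 0 \<longleftrightarrow> x = 0"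
  by (auto simp: norm1_def sum_nonneg_eq_0_iff vec_eq_iff)

lemma norm1_scaleR: "norm1 (c *\<^sub>R x) = \<bar>c\<bar> * norm1 x"
  by (simp add: norm1_def abs_mult sum_distrib_left)

lemma norm1_triangle_ineq: "norm1 (x + y) \<le> norm1 x + norm1 y"
  by (simp add: norm1_def abs_triangle_ineq sum_mono flip: sum.distrib)

text \<open>On nonnegative entries the absolute values in \<open>norm1\<close> disappear. The norm
  condition becomes linear, so closure under midpoints and under \<open>tensor_app\<close> reduces
  to computing sums.\<close>

lemma stochastic_vectors_iff:
  "x \<in> stochastic_vectors \<longleftrightarrow> (\<forall>i. 0 \<le> x $ i) \<and> (\<Sum>i\<in>UNIV. x $ i) = 1"
  by (auto simp: stochastic_vectors_def norm1_def)

lemma midpoint_stochastic_vectors: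
  assumes "x \<in> stochastic_vectors" "y \<in> stochastic_vectors"
  shows "midpoint x y \<in> stochastic_vectors"
  using assms
  by (simp add: stochastic_vectors_iff midpoint_def sum.distrib flip: sum_divide_distrib sum_distrib_left)

lemma tensor_app_scaleR_left: "tensor_app P (c *\<^sub>R x) y = c *\<^sub>R tensor_app P x y"
  by (simp add: tensor_app_def vec_eq_iff sum_distrib_left mult_ac)

lemma tensor_app_scaleR_right: "tensor_app P x (c *\<^sub>R y) = c *\<^sub>R tensor_app P x y"
  by (simp add: tensor_app_def vec_eq_iff sum_distrib_left mult_ac)

lemma tensor_app_diff_tensor: "tensor_app (P - Q) x y = tensor_app P x y - tensor_app Q x y"
  by (simp add: tensor_app_def vec_eq_iff left_diff_distrib sum_subtractf)

text \<open>Polarisation of a quadratic map: for each pair \<open>j\<close>, \<open>k\<close> the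
  mixed terms \<open>x $ j * y $ k\<close> and \<open>y $ j * x $ k\<close> cancel between the two
  summands. The right side has the shape measured by \<open>ergodicity_coeff\<close>.\<close>

lemma tensor_app_diag_diff:
  "tensor_app P x x - tensor_app P y y =
    tensor_app P (midpoint x y) (x - y) + tensor_app P (x - y) (midpoint x y)"
proof -
  have "P $ i $ j $ k * x $ j * x $ k - P $ i $ j $ k * y $ j * y $ k =
      P $ i $ j $ k * midpoint x y $ j * (x - y) $ k +
      P $ i $ j $ k * (x - y) $ j * midpoint x y $ k" for i j k
    by (simp add: midpoint_def field_simps)
  then show ?thesis
    unfolding tensor_app_def vec_eq_iff
    by (simp flip: sum.distrib sum_subtractf)
qed

text \<open>Summing over \<open>i\<close> first exposes the column sums: they are 1 for a stochastic
  tensor, and for entrywise absolute values they are bounded by \<open>tensor_norm1\<close>.\<close>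

lemma sum_tensor_app:
  "(\<Sum>i\<in>UNIV. tensor_app P x y $ i) =
    (\<Sum>j\<in>UNIV. \<Sum>k\<in>UNIV. (\<Sum>i\<in>UNIV. P $ i $ j $ k) * (x $ j * y $ k))"
proof -
  have "(\<Sum>i\<in>UNIV. tensor_app P x y $ i) =
      (\<Sum>i\<in>UNIV. \<Sum>j\<in>UNIV. \<Sum>k\<in>UNIV. P $ i $ j $ k * x $ j * y $ k)"
    by (simp add: tensor_app_def)
  also have "\<dots> = (\<Sum>j\<in>UNIV. \<Sum>i\<in>UNIV. \<Sum>k\<in>UNIV. P $ i $ j $ k * x $ j * y $ k)"
    by (rule sum.swap)
  also have "\<dots> = (\<Sum>j\<in>UNIV. \<Sum>k\<in>UNIV. \<Sum>i\<in>UNIV. P $ i $ j $ k * x $ j * y $ k)"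
    by (intro sum.cong refl sum.swap)
  finally show ?thesis
    by (simp add: sum_distrib_right mult.assoc)
qed

lemma tensor_app_stochastic:
  assumes "stochastic_tensor P" "x \<in> stochastic_vectors" "y \<in> stochastic_vectors"
  shows "tensor_app P x y \<in> stochastic_vectors"
proof -
  \<comment> \<open>With unit column sums the double sum factors into the entry sums of
    \<open>x\<close> and \<open>y\<close>, both equal to 1.\<close>
  have "(\<Sum>i\<in>UNIV. tensor_app P x y $ i) = (\<Sum>j\<in>UNIV. x $ j * (\<Sum>k\<in>UNIV. y $ k))"
    using assms(1) by (simp add: sum_tensor_app stochastic_tensor_def sum_distrib_left)
  then show ?thesis
    using assms by (auto simp: stochastic_vectors_iff stochastic_tensor_def tensor_app_def
        intro!: sum_nonneg)
qed

lemma norm1_tensor_app_le: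
  "norm1 (tensor_app P x y) \<le> tensor_norm1 P * norm1 x * norm1 y"
proof -
  \<comment> \<open>Passing to absolute values in the tensor and both vectors turns the norm into a
    plain sum of components, to which \<open>sum_tensor_app\<close> applies.\<close>
  let ?abs = "\<lambda>v. \<chi> i. \<bar>v $ i\<bar>"
  let ?Q = "\<chi> i j k. \<bar>P $ i $ j $ k\<bar>"
  have "norm1 (tensor_app P x y) \<le> (\<Sum>i\<in>UNIV. tensor_app ?Q (?abs x) (?abs y) $ i)"
    unfolding norm1_def
  proof (rule sum_mono)
    fix i
    have "\<bar>tensor_app P x y $ i\<bar> \<le> (\<Sum>j\<in>UNIV. \<bar>\<Sum>k\<in>UNIV. P $ i $ j $ k * x $ j * y $ k\<bar>)"
      unfolding tensor_app_def by simp
    also have "\<dots> \<le> (\<Sum>j\<in>UNIV. \<Sum>k\<in>UNIV. \<bar>P $ i $ j $ k * x $ j * y $ k\<bar>)"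
      by (intro sum_mono sum_abs)
    finally show "\<bar>tensor_app P x y $ i\<bar> \<le> tensor_app ?Q (?abs x) (?abs y) $ i"
      by (simp add: tensor_app_def abs_mult)
  qed
  also have "\<dots> = (\<Sum>j\<in>UNIV. \<Sum>k\<in>UNIV. (\<Sum>i\<in>UNIV. \<bar>P $ i $ j $ k\<bar>) * (\<bar>x $ j\<bar> * \<bar>y $ k\<bar>))"
    by (simp add: sum_tensor_app)
  also have "\<dots> \<le> (\<Sum>j\<in>UNIV. \<Sum>k\<in>UNIV. tensor_norm1 P * (\<bar>x $ j\<bar> * \<bar>y $ k\<bar>))"
  proof (intro sum_mono mult_right_mono)
    show "(\<Sum>i\<in>UNIV. \<bar>P $ i $ j $ k\<bar>) \<le> tensor_norm1 P" for j k
      unfolding tensor_norm1_def by (rule Max_ge) auto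
  qed simp
  also have "\<dots> = tensor_norm1 P * norm1 x * norm1 y"
    unfolding norm1_def mult.assoc sum_product by (simp only: sum_distrib_left)
  finally show ?thesis .
qed

lemma tensor_app_diag_lipschitz:
  fixes P :: "('n::finite) cubic_tensor"
  assumes "CARD('n) \<ge> 2" "x \<in> stochastic_vectors" "y \<in> stochastic_vectors"
  shows "norm1 (tensor_app P x x - tensor_app P y y) \<le> ergodicity_coeff P * norm1 (x - y)"
proof (cases "x = y")
  case True
  then show ?thesis by (simp add: norm1_def)
next
  case False
  let ?m = "midpoint x y"
  define c where "c = norm1 (x - y)"
  \<comment> \<open>\<open>ergodicity_coeff\<close> tests only zero-sum vectors of norm 1, so the
    difference is normalised; bilinearity later restores the factor \<open>c\<close>.\<close>
  define u where "u = inverse c *\<^sub>R (x - y)"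
  have c: "c > 0"
    using False norm1_nonneg[of "x - y"] norm1_eq_0_iff[of "x - y"] by (simp add: c_def)
  have "(\<Sum>i\<in>UNIV. (x - y) $ i) = 0"
    using assms by (simp add: stochastic_vectors_iff sum_subtractf)
  then have "(\<Sum>i\<in>UNIV. u $ i) = 0"
    unfolding u_def vector_scaleR_component real_scaleR_def by (simp flip: sum_distrib_left)
  moreover have "norm1 u = 1"
    using c by (simp add: u_def norm1_scaleR flip: c_def)
  ultimately have u: "u \<in> zero_sum_sphere"
    by (simp add: zero_sum_sphere_def)
  have "x - y = c *\<^sub>R u"
    using c by (simp add: u_def)
  then have "tensor_app P x x - tensor_app P y y =
      c *\<^sub>R (tensor_app P ?m u + tensor_app P u ?m)"
    by (simp add: tensor_app_diag_diff tensor_app_scaleR_left tensor_app_scaleR_right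
        scaleR_add_right)
  then have "norm1 (tensor_app P x x - tensor_app P y y) =
      c * norm1 (tensor_app P ?m u + tensor_app P u ?m)"
    using c by (simp add: norm1_scaleR)
  \<comment> \<open>In dimension at least 2 the coefficient is an attained maximum, hence a genuine
    upper bound at the pair \<open>?m\<close>, \<open>u\<close>.\<close>
  also have "\<dots> \<le> c * ergodicity_coeff P"
    using c ergodicity_coeff_attained[OF assms(1), of P] u
      midpoint_stochastic_vectors[OF assms(2,3)] by (intro mult_left_mono) auto
  finally show ?thesis
    by (simp add: c_def mult.commute)
qed

text \<open>
  Compactness replaces completeness: a minimiser of the defect \<open>norm1 (x - P x x)\<close> must have zero
  defect, because applying the contraction to it would lower the defect.
\<close>

lemma stochastic_fixed_point_exists:
  fixes P :: "('n::finite) cubic_tensor"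
  assumes "CARD('n) \<ge> 2" "stochastic_tensor P" "ergodicity_coeff P < 1"
  shows "\<exists>x\<in>stochastic_vectors. x = tensor_app P x x"
proof -
  let ?f = "\<lambda>x. tensor_app P x x"
  have "continuous_on stochastic_vectors (\<lambda>x. norm1 (x - ?f x))"
    by (intro continuous_intros)
  then obtain x where x: "x \<in> stochastic_vectors"
    and min: "\<And>y. y \<in> stochastic_vectors \<Longrightarrow> norm1 (x - ?f x) \<le> norm1 (y - ?f y)"
    using continuous_attains_inf[OF compact_stochastic_vectors stochastic_vectors_nonempty] by blast
  have fx: "?f x \<in> stochastic_vectors"
    using assms(2) x x by (rule tensor_app_stochastic)
  have "norm1 (x - ?f x) \<le> norm1 (?f x - ?f (?f x))"
    using fx by (rule min)
  also have "\<dots> \<le> ergodicity_coeff P * norm1 (x - ?f x)"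
    using assms(1) x fx by (rule tensor_app_diag_lipschitz)
  finally have "(1 - ergodicity_coeff P) * norm1 (x - ?f x) \<le> 0"
    by (simp add: algebra_simps)
  then have "norm1 (x - ?f x) = 0"
    using assms(3) norm1_nonneg[of "x - ?f x"] by (simp add: mult_le_0_iff)
  then show ?thesis
    using x by (auto simp: norm1_eq_0_iff)
qed

lemma stochastic_fixed_point_perturbation:
  fixes P P' :: "('n::finite) cubic_tensor"
  assumes "CARD('n) \<ge> 2" "ergodicity_coeff P < 1"
    and x: "x \<in> stochastic_vectors" "x = tensor_app P x x"
    and x': "x' \<in> stochastic_vectors" "x' = tensor_app P' x' x'"
  shows "norm1 (x - x') \<le> tensor_norm1 (P - P') / (1 - ergodicity_coeff P)"
proof -
  have "x - x' = (tensor_app P x x - tensor_app P x' x') + tensor_app (P - P') x' x'"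
    using x(2) x'(2) by (simp add: tensor_app_diff_tensor)
  then have "norm1 (x - x') \<le>
      norm1 (tensor_app P x x - tensor_app P x' x') + norm1 (tensor_app (P - P') x' x')"
    using norm1_triangle_ineq by metis
  \<comment> \<open>The vector \<open>x'\<close> has norm 1, so only the tensor norm survives in the
    second term. The first is then absorbed on the left, where its factor becomes
    \<open>1 - ergodicity_coeff P > 0\<close>.\<close>
  also have "\<dots> \<le> ergodicity_coeff P * norm1 (x - x') + tensor_norm1 (P - P')"
    using tensor_app_diag_lipschitz[OF assms(1) x(1) x'(1), of P]
      norm1_tensor_app_le[of "P - P'" x' x'] x'(1)
    by (simp add: stochastic_vectors_def)
  finally show ?thesis
    using assms(2) by (simp add: field_simps)
qed

theorem theorem6p4:
  fixes P P' :: "('n::finite) cubic_tensor"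
  assumes "CARD('n) \<ge> 2"
    and "stochastic_tensor P"
    and "stochastic_tensor P'"
    and "ergodicity_coeff P < 1"
  shows "(\<exists>!x. x \<in> stochastic_vectors \<and> x = tensor_app P x x) \<and>
    (\<forall>x\<in>stochastic_vectors. x = tensor_app P x x \<longrightarrow>
      (\<forall>x'\<in>stochastic_vectors. x' = tensor_app P' x' x' \<longrightarrow>
        norm1 (x - x') \<le> tensor_norm1 (P - P') / (1 - ergodicity_coeff P)))"
proof (intro conjI ballI impI)
  \<comment> \<open>Uniqueness is the perturbation bound for the zero perturbation
    \<open>P' = P\<close>.\<close>
  have zero: "tensor_norm1 (P - P) = 0"
    by (simp add: tensor_norm1_def case_prod_beta)
  have "x = y" if "x \<in> stochastic_vectors" "x = tensor_app P x x"
    "y \<in> stochastic_vectors" "y = tensor_app P y y" for x y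
  proof -
    have "norm1 (x - y) \<le> 0"
      using stochastic_fixed_point_perturbation[OF assms(1,4) that] unfolding zero by simp
    then show ?thesis
      using norm1_nonneg[of "x - y"] norm1_eq_0_iff[of "x - y"] by simp
  qed
  then show "\<exists>!x. x \<in> stochastic_vectors \<and> x = tensor_app P x x"
    using stochastic_fixed_point_exists[OF assms(1,2,4)] by blast
qed (rule stochastic_fixed_point_perturbation[OF assms(1,4)])

end
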